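(* For all $m,n\in\mathbb{Q}_{>0}$ with $m\neq n$ and every integer $N\ge3$, writing $N'=N-1$, $$\sum_{\substack{j+k=N\\ j\ge1,\,k\ge2}}\zeta^\mu(j,k;n,m+n)=\zeta^\mu(1,N';m,n)-\zeta^\mu(1,N';m,m+n)-\mu\frac{\mathcal{D}^\mu(1;m;n)}{(n-m)^{N-1}}+\mathcal{D}^\mu(N',1;n,m;n,m+n)+\mu\sum_{\substack{i+k=N-2\\ i\ge1,\,k\ge0}}\frac{\zeta^\mu(k+2;n)}{(n-m)^{i}}.$$ Moreover, for every $n\in\mathbb{Q}_{>0}$ and $N\ge3$, $$\sum_{\substack{j+k=N\\ j\ge1,\,k\ge2}}\zeta^\mu(j,k;n,2n)=\zeta^\mu(1,N';n,n)-\zeta^\mu(1,N';n,2n)-\mu\,\zeta^\mu(N;n)+\mathcal{D}^\mu(N',1;n,n;n,2n).$$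
   Context: Fix $\mu\in\mathbb{C}$ with $\mathrm{Re}(\mu)>0$. For $k_1,\dots,k_r\in\mathbb{N}$ with $k_r\ge2$ and $m_1,\dots,m_r\in\mathbb{Q}_{>0}$, $\zeta^\mu(k_1,\dots,k_r;m_1,\dots,m_r)=\sum_{0\le n_1\le\cdots\le n_r}\frac{\mu^r}{(n_1\mu+m_1)^{k_1}\cdots(n_r\mu+m_r)^{k_r}}$. For $k_1,\dots,k_{r-1}\in\mathbb{N}$ and positive rationals $m_1,\dots,m_r,\tilde m_r$ with $m_r\neq\tilde m_r$, $\mathcal{D}^\mu(k_1,\dots,k_{r-1},1;m_1,\dots,m_r;m_1,\dots,m_{r-1},\tilde m_r)=(\tilde m_r-m_r)\sum_{0\le n_1\le\cdots\le n_r}\frac{\mu^r}{\prod_{i=1}^{r-1}(n_i\mu+m_i)^{k_i}\,(n_r\mu+m_r)(n_r\mu+\tilde m_r)}$. In particular $\mathcal{D}^\mu(1;m;n)=(n-m)\sum_{q\ge0}\frac{\mu}{(q\mu+m)(q\mu+n)}$. *)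

theory Defs
  imports "HOL-Analysis.Analysis"
begin

definition weak_chains :: "nat \<Rightarrow> nat list set" where
  "weak_chains r = {ns. length ns = r \<and> sorted ns}"

text \<open>The depth is \<open>r = length ks\<close>; \<open>ks\<close> and \<open>ms\<close> are meant to have equal length. Lists are
  0-based, so \<open>ks ! i\<close> is the (i+1)-st exponent. For positive exponents with the last one at
  least 2, positive shifts and \<open>Re \<mu> > 0\<close> the series converges absolutely, so the unordered
  sum is the ordinary one.\<close>

definition zeta_mu :: "complex \<Rightarrow> nat list \<Rightarrow> rat list \<Rightarrow> complex" where
  "zeta_mu \<mu> ks ms =
     (\<Sum>\<^sub>\<infinity>ns\<in>weak_chains (length ks).
        \<mu> ^ length ks / (\<Prod>i<length ks. (of_nat (ns ! i) * \<mu> + of_rat (ms ! i)) ^ (ks ! i)))"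

text \<open>Only for arguments with \<open>last ks = 1\<close> and \<open>butlast ms = butlast ms'\<close>, all three lists being
  nonempty and of equal length; the last exponent 1 and \<open>butlast ms'\<close> are therefore not used.\<close>

definition D_mu :: "complex \<Rightarrow> nat list \<Rightarrow> rat list \<Rightarrow> rat list \<Rightarrow> complex" where
  "D_mu \<mu> ks ms ms' =
     of_rat (last ms' - last ms) *
     (\<Sum>\<^sub>\<infinity>ns\<in>weak_chains (length ks).
        \<mu> ^ length ks /
        ((\<Prod>i<length ks - 1. (of_nat (ns ! i) * \<mu> + of_rat (ms ! i)) ^ (ks ! i)) *
         (of_nat (last ns) * \<mu> + of_rat (last ms)) *
         (of_nat (last ns) * \<mu> + of_rat (last ms'))))"

end

theory Submission
  imports Defs
begin

text \<open>Put \<open>a = p\<mu> + n\<close>, \<open>c = s\<mu> + m\<close> and \<open>b = a + c\<close>, so that a term of \<open>\<zeta>\<^sup>\<mu>(j,k;n,m+n)\<close> is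
  \<open>\<mu>\<^sup>2 / (a\<^sup>j b\<^sup>k)\<close> with \<open>p, s \<ge> 0\<close> free. Since \<open>b - a = c\<close>, the geometric sum over \<open>j + k = N\<close>, \<open>k \<ge> 2\<close>,
  equals \<open>a\<^bsup>-(N-1)\<^esup> (1/c - 1/b) - 1/(c b\<^bsup>N-1\<^esup>)\<close>. The last term sums to \<open>\<zeta>\<^sup>\<mu>(1,N-1;m,m+n)\<close>.
  For the first, telescoping in \<open>s\<close> replaces \<open>\<Sum>\<^sub>s (1/c\<^sub>s - 1/b\<^sub>p\<^sub>+\<^sub>s)\<close> by the finite sum of \<open>1/c\<^sub>s\<close>
  over \<open>s < p\<close> plus a sum over \<open>s \<ge> p\<close>, which give \<open>\<zeta>\<^sup>\<mu>(1,N-1;m,n)\<close> without its diagonal, and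
  \<open>\<D>\<^sup>\<mu>(N-1,1;n,m;n,m+n)\<close>. The diagonal \<open>\<Sum>\<^sub>p \<mu>\<^sup>2 / ((p\<mu>+m)(p\<mu>+n)\<^bsup>N-1\<^esup>)\<close> is evaluated by partial
  fractions.\<close>

section \<open>Rearrangement of double series\<close>

lemma has_sum_diff:
  fixes f g :: "'a \<Rightarrow> 'b::topological_ab_group_add"
  assumes "(f has_sum x) A" "(g has_sum y) A"
  shows "((\<lambda>i. f i - g i) has_sum (x - y)) A"
  using has_sum_add[OF assms(1), of "\<lambda>i. - g i" "- y"] assms(2)
  by (simp add: has_sum_uminus)

lemma has_sum_sum:
  fixes f :: "'a \<Rightarrow> 'b \<Rightarrow> 'c::topological_comm_monoid_add"
  assumes "\<And>i. i \<in> I \<Longrightarrow> (f i has_sum S i) A"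
  shows "((\<lambda>x. \<Sum>i\<in>I. f i x) has_sum (\<Sum>i\<in>I. S i)) A"
  using assms by (induction I rule: infinite_finite_induct) (auto intro!: has_sum_add)

text \<open>Induction on the shift: passing from \<open>p\<close> to \<open>Suc p\<close> adds the
  differences of consecutive terms of the sequence started at \<open>p\<close>, which telescope to
  \<open>f p\<close> because \<open>f\<close> tends to 0.\<close>

lemma sums_diff_shift:
  fixes f :: "nat \<Rightarrow> 'a::real_normed_vector"
  assumes "f \<longlonglongrightarrow> 0"
  shows "(\<lambda>t. f t - f (t + p)) sums (\<Sum>s<p. f s)"
proof (induction p)
  case 0
  show ?case by simp
next
  case (Suc p)
  have "(\<lambda>t. f (t + p)) \<longlonglongrightarrow> 0"
    using assms by (rule LIMSEQ_ignore_initial_segment)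
  from telescope_sums'[OF this] have "(\<lambda>t. f (t + p) - f (Suc t + p)) sums f p"
    by simp
  from sums_add[OF Suc.IH this] show ?case by simp
qed

text \<open>For fixed \<open>p\<close>, subtract the row of \<open>D\<close> from the row of
  \<open>X\<close>: the \<open>g\<close> parts cancel, and the remaining differences
  \<open>f s - f (s + p)\<close> telescope to the sum of \<open>f s\<close> over
  \<open>s < p\<close>. The triangle of \<open>Z\<close> also contains \<open>s = p\<close>, hence
  the correction \<open>W\<close>. Only combined series are summed, since that of \<open>f\<close>
  alone may diverge.\<close>

lemma double_sum_shift:
  fixes a f g :: "nat \<Rightarrow> complex"
  assumes lim: "f \<longlonglongrightarrow> 0"
    and X: "((\<lambda>(p, s). a p * (f s - g (p + s))) has_sum X) UNIV"
    and D: "((\<lambda>(p, t). a p * (f (p + t) - g (p + t))) has_sum D) UNIV"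
    and Z: "((\<lambda>(q, p). a q * f p) has_sum Z) (SIGMA q:UNIV. {..q})"
    and W: "((\<lambda>p. a p * f p) has_sum W) UNIV"
  shows "X = Z + D - W"
proof -
  define x where "x p = (\<Sum>\<^sub>\<infinity>s. a p * (f s - g (p + s)))" for p
  define d where "d p = (\<Sum>\<^sub>\<infinity>t. a p * (f (p + t) - g (p + t)))" for p
  have X': "((\<lambda>(p, s). a p * (f s - g (p + s))) has_sum X) (UNIV \<times> UNIV)"
    and D': "((\<lambda>(p, t). a p * (f (p + t) - g (p + t))) has_sum D) (UNIV \<times> UNIV)"
    using X D by simp_all
  have x: "((\<lambda>s. a p * (f s - g (p + s))) has_sum x p) UNIV" for p
    unfolding x_def
    using summable_on_SigmaD1[OF has_sum_imp_summable[OF X'], of p] by simp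
  have d: "((\<lambda>t. a p * (f (p + t) - g (p + t))) has_sum d p) UNIV" for p
    unfolding d_def
    using summable_on_SigmaD1[OF has_sum_imp_summable[OF D'], of p] by simp
  have hx: "(x has_sum X) UNIV"
    by (rule has_sum_SigmaD[OF X']) (use x in auto)
  have hd: "(d has_sum D) UNIV"
    by (rule has_sum_SigmaD[OF D']) (use d in auto)
  have hz: "((\<lambda>q. \<Sum>p\<le>q. a q * f p) has_sum Z) UNIV"
    by (rule has_sum_SigmaD[OF Z]) auto
  have "x p - d p = (\<Sum>s\<le>p. a p * f s) - a p * f p" for p
  proof -
    have "(\<lambda>s. a p * (f s - g (p + s)) - a p * (f (p + s) - g (p + s))) sums (x p - d p)"
      by (intro sums_diff has_sum_imp_sums x d)
    also have "(\<lambda>s. a p * (f s - g (p + s)) - a p * (f (p + s) - g (p + s))) =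
               (\<lambda>s. a p * (f s - f (s + p)))"
      by (simp add: algebra_simps)
    finally have "(\<lambda>s. a p * (f s - f (s + p))) sums (x p - d p)" .
    moreover have "(\<lambda>s. a p * (f s - f (s + p))) sums (a p * (\<Sum>s<p. f s))"
      by (intro sums_mult sums_diff_shift lim)
    ultimately have "x p - d p = a p * (\<Sum>s<p. f s)"
      by (rule sums_unique2)
    also have "\<dots> = (\<Sum>s\<le>p. a p * f s) - a p * f p"
      by (simp add: sum_distrib_left flip: lessThan_Suc_atMost)
    finally show ?thesis .
  qed
  hence eq: "x = (\<lambda>p. (\<Sum>s\<le>p. a p * f s) + d p - a p * f p)"
    by (auto simp: fun_eq_iff algebra_simps)
  have "(x has_sum (Z + D - W)) UNIV"
    unfolding eq by (intro has_sum_diff has_sum_add hz hd W)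
  with hx show ?thesis
    by (rule has_sum_unique)
qed

section \<open>Absolute convergence\<close>

text \<open>The total degree 3 of the denominator is shared equally between the two indices. As
  \<open>p + s + 1\<close> dominates both \<open>p + 1\<close> and \<open>s + 1\<close>, the
  majorant is at most a product of two convergent series with exponent 3/2.\<close>

lemma summable_on_pairs_comparison:
  fixes f :: "nat \<times> nat \<Rightarrow> complex"
  assumes "\<And>p s. norm (f (p, s)) \<le> K / (real (p + 1) * real (p + s + 1) ^ 2)"
  shows "f summable_on UNIV"
proof -
  define w where "w p = real (Suc p) powr (- 3 / 2)" for p
  have "summable (\<lambda>p. real p powr (- 3 / 2))"
    by (subst summable_real_powr_iff) auto
  hence "summable w"
    unfolding w_def by (subst summable_Suc_iff)
  hence w: "w summable_on UNIV"
    by (subst summable_on_UNIV_nonneg_real_iff) (auto simp: w_def)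
  have w_nonneg: "w p \<ge> 0" for p
    by (simp add: w_def)
  \<comment> \<open>At \<open>p = s = 0\<close> the denominator is 1, so the hypothesis bounds a
    norm by \<open>K\<close> itself.\<close>
  have K: "K \<ge> 0"
    using order.trans[OF norm_ge_zero assms[of 0 0]] by simp
  have "(\<lambda>x. norm (case x of (p, s) \<Rightarrow> w p * w s)) summable_on (UNIV \<times> UNIV)"
    unfolding Infinite_Sum.abs_summable_on_Sigma_iff
    using w w_nonneg
    by (auto simp: abs_mult infsum_cmult_right' infsum_nonneg
             intro!: summable_on_cmult_right summable_on_cmult_left)
  hence "(\<lambda>x. norm (K * (case x of (p, s) \<Rightarrow> w p * w s))) summable_on UNIV"
    by (simp add: abs_mult summable_on_cmult_right)
  hence "(\<lambda>x. norm (f x)) summable_on UNIV"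
  proof (rule Infinite_Sum.abs_summable_on_comparison_test)
    fix x :: "nat \<times> nat"
    obtain p s where x: "x = (p, s)" by (cases x)
    define u where "u = real (Suc p)"
    define v where "v = real (Suc s)"
    define t where "t = real (p + s + 1)"
    have u: "u \<ge> 1" and v: "v \<ge> 1" and t: "t \<ge> u" "t \<ge> v" "t > 0"
      by (auto simp: u_def v_def t_def)
    have "u powr (3/2) * v powr (3/2) = u * (u powr (1/2) * v powr (3/2))"
      using u powr_add[of u 1 "1/2"] by simp
    \<comment> \<open>One factor \<open>u\<close> is kept; the surplus \<open>u powr (1/2)\<close>
      and all of \<open>v powr (3/2)\<close> are absorbed by \<open>t\<close>, whose exponents add
      up to 2.\<close>
    also have "\<dots> \<le> u * (t powr (1/2) * t powr (3/2))"
      using u v t by (intro mult_left_mono mult_mono powr_mono2) auto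
    also have "t powr (1/2) * t powr (3/2) = t ^ 2"
      using t by (simp flip: powr_add)
    finally have le: "u powr (3/2) * v powr (3/2) \<le> u * t ^ 2" .
    have "norm (f x) \<le> K / (u * t ^ 2)"
      using assms[of p s] by (simp add: x u_def t_def)
    also have "\<dots> \<le> K / (u powr (3/2) * v powr (3/2))"
      using K u v le t by (intro divide_left_mono) auto
    also have "\<dots> = K * (w p * w s)"
      unfolding w_def u_def v_def by (simp add: powr_minus_divide)
    finally show "norm (f x) \<le> norm (K * (case x of (p, s) \<Rightarrow> w p * w s))"
      by (simp add: x)
  qed
  thus ?thesis
    by (rule abs_summable_summable)
qed

lemma linear_nonzero:
  fixes \<mu> \<alpha> :: complex
  assumes "Re \<mu> > 0" "Re \<alpha> > 0"
  shows "of_nat p * \<mu> + \<alpha> \<noteq> 0"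
proof -
  have "Re (of_nat p * \<mu> + \<alpha>) > 0"
    using assms by (simp add: add_nonneg_pos)
  thus ?thesis by (metis less_irrefl zero_complex.sel(1))
qed

text \<open>The real part already gives growth: with \<open>c\<close> the smaller of
  \<open>Re \<mu>\<close> and \<open>Re \<alpha>\<close>, the linear form has norm at least
  \<open>c * (p + 1)\<close>. Lowering the exponent from \<open>k\<close> to \<open>i\<close> is
  harmless because \<open>p + 1 \<ge> 1\<close>.\<close>

lemma norm_inverse_linear_power_le:
  fixes \<mu> \<alpha> :: complex
  assumes "Re \<mu> > 0" "Re \<alpha> > 0" "i \<le> k"
  shows "\<exists>C>0. \<forall>p. norm (1 / (of_nat p * \<mu> + \<alpha>) ^ k) \<le> C / real (p + 1) ^ i"
proof -
  define c where "c = min (Re \<mu>) (Re \<alpha>)"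
  have c: "c > 0" "c \<le> Re \<mu>" "c \<le> Re \<alpha>"
    using assms by (auto simp: c_def)
  have "norm (1 / (of_nat p * \<mu> + \<alpha>) ^ k) \<le> (1 / c ^ k) / real (p + 1) ^ i" for p
  proof -
    have "c * real (p + 1) = real p * c + c"
      by (simp add: algebra_simps)
    also have "\<dots> \<le> Re (of_nat p * \<mu> + \<alpha>)"
      using c by (simp add: add_mono mult_left_mono)
    also have "\<dots> \<le> norm (of_nat p * \<mu> + \<alpha>)"
      by (rule complex_Re_le_cmod)
    finally have "(c * real (p + 1)) ^ k \<le> norm (of_nat p * \<mu> + \<alpha>) ^ k"
      using c by (intro power_mono) auto
    moreover have "c ^ k * real (p + 1) ^ i \<le> (c * real (p + 1)) ^ k"
      unfolding power_mult_distrib using c assms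
      by (intro mult_left_mono power_increasing) auto
    ultimately have "c ^ k * real (p + 1) ^ i \<le> norm (of_nat p * \<mu> + \<alpha>) ^ k"
      by linarith
    moreover have "0 < c ^ k * real (p + 1) ^ i"
      using c by simp
    ultimately have "1 / norm (of_nat p * \<mu> + \<alpha>) ^ k \<le> 1 / (c ^ k * real (p + 1) ^ i)"
      by (intro frac_le) auto
    thus ?thesis
      by (simp add: norm_divide norm_power)
  qed
  thus ?thesis
    using c by (intro exI[of _ "1 / c ^ k"]) auto
qed

lemma inverse_linear_tendsto_0:
  fixes \<mu> \<alpha> :: complex
  assumes "Re \<mu> > 0" "Re \<alpha> > 0"
  shows "(\<lambda>p. 1 / (of_nat p * \<mu> + \<alpha>)) \<longlonglongrightarrow> 0"
proof -
  obtain C where C: "\<And>p. norm (1 / (of_nat p * \<mu> + \<alpha>) ^ 1) \<le> C / real (p + 1) ^ 1"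
    using norm_inverse_linear_power_le[OF assms, of 1 1] by blast
  have "(\<lambda>p. C / real (p + 1)) \<longlonglongrightarrow> 0"
    using LIMSEQ_ignore_initial_segment[OF lim_const_over_n[of C], of 1] by simp
  thus ?thesis
    by (rule Lim_null_comparison[rotated]) (use C in auto)
qed

text \<open>Two factors serve both series of depth one: exponents \<open>k\<close> and 0 give
  \<open>zeta_mu\<close>, exponents 1 and 1 give \<open>D_mu\<close>.\<close>

lemma summable_on_inverse_linear_product:
  fixes \<mu> \<alpha> \<beta> :: complex
  assumes "Re \<mu> > 0" "Re \<alpha> > 0" "Re \<beta> > 0" "j + k \<ge> 2"
  shows "(\<lambda>p. 1 / ((of_nat p * \<mu> + \<alpha>) ^ j * (of_nat p * \<mu> + \<beta>) ^ k)) summable_on UNIV"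
proof -
  obtain C where C: "C > 0" "\<And>p. norm (1 / (of_nat p * \<mu> + \<alpha>) ^ j) \<le> C / real (p + 1) ^ j"
    using norm_inverse_linear_power_le[OF assms(1,2), of j j] by blast
  obtain C' where C': "C' > 0" "\<And>p. norm (1 / (of_nat p * \<mu> + \<beta>) ^ k) \<le> C' / real (p + 1) ^ k"
    using norm_inverse_linear_power_le[OF assms(1,3), of k k] by blast
  have "summable (\<lambda>p. C * C' * inverse (real (Suc p) ^ (j + k)))"
    using assms(4) inverse_power_summable[of "j + k", where 'a = real]
    by (intro summable_mult) (subst summable_Suc_iff, simp)
  hence "summable (\<lambda>p. norm (1 / ((of_nat p * \<mu> + \<alpha>) ^ j * (of_nat p * \<mu> + \<beta>) ^ k)))"
  proof (rule summable_comparison_test'[where N = 0])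
    fix p
    have "norm (1 / ((of_nat p * \<mu> + \<alpha>) ^ j * (of_nat p * \<mu> + \<beta>) ^ k)) =
          norm (1 / (of_nat p * \<mu> + \<alpha>) ^ j) * norm (1 / (of_nat p * \<mu> + \<beta>) ^ k)"
      by (simp add: norm_divide norm_mult)
    also have "\<dots> \<le> (C / real (p + 1) ^ j) * (C' / real (p + 1) ^ k)"
      using C C' by (intro mult_mono) auto
    also have "\<dots> = C * C' * inverse (real (Suc p) ^ (j + k))"
      by (simp add: power_add divide_inverse)
    finally show "norm (norm (1 / ((of_nat p * \<mu> + \<alpha>) ^ j * (of_nat p * \<mu> + \<beta>) ^ k)))
        \<le> C * C' * inverse (real (Suc p) ^ (j + k))" by simp
  qed
  thus ?thesis by (rule norm_summable_imp_summable_on)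
qed

text \<open>Three factors serve both series of depth two: \<open>D_mu\<close> has two different
  shifts at the larger index, while \<open>zeta_mu\<close> is the case of equal shifts with its last
  exponent split in two. Bounding each factor to first order gives exactly the majorant of
  \<open>summable_on_pairs_comparison\<close>.\<close>

lemma summable_on_pairs_inverse_linear_product:
  fixes \<mu> \<alpha> \<beta> \<gamma> :: complex
  assumes "Re \<mu> > 0" "Re \<alpha> > 0" "Re \<beta> > 0" "Re \<gamma> > 0" "j \<ge> 1" "k \<ge> 1" "l \<ge> 1"
  shows "(\<lambda>(p, t). 1 / ((of_nat p * \<mu> + \<alpha>) ^ j * (of_nat (p + t) * \<mu> + \<beta>) ^ k *
           (of_nat (p + t) * \<mu> + \<gamma>) ^ l)) summable_on UNIV"
proof -
  obtain A where A: "A > 0" "\<And>p. norm (1 / (of_nat p * \<mu> + \<alpha>) ^ j) \<le> A / real (p + 1) ^ 1"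
    using norm_inverse_linear_power_le[OF assms(1,2,5)] by blast
  obtain B where B: "B > 0" "\<And>p. norm (1 / (of_nat p * \<mu> + \<beta>) ^ k) \<le> B / real (p + 1) ^ 1"
    using norm_inverse_linear_power_le[OF assms(1,3,6)] by blast
  obtain C where C: "C > 0" "\<And>p. norm (1 / (of_nat p * \<mu> + \<gamma>) ^ l) \<le> C / real (p + 1) ^ 1"
    using norm_inverse_linear_power_le[OF assms(1,4,7)] by blast
  show ?thesis
  proof (rule summable_on_pairs_comparison, unfold prod.case)
    fix p t
    have "norm (1 / ((of_nat p * \<mu> + \<alpha>) ^ j * (of_nat (p + t) * \<mu> + \<beta>) ^ k *
            (of_nat (p + t) * \<mu> + \<gamma>) ^ l)) =
          norm (1 / (of_nat p * \<mu> + \<alpha>) ^ j) * norm (1 / (of_nat (p + t) * \<mu> + \<beta>) ^ k) *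
          norm (1 / (of_nat (p + t) * \<mu> + \<gamma>) ^ l)"
      by (simp add: norm_divide norm_mult)
    also have "\<dots> \<le> A / real (p + 1) ^ 1 * (B / real (p + t + 1) ^ 1) * (C / real (p + t + 1) ^ 1)"
      using A(1) B(1) C(1) by (intro mult_mono A(2) B(2) C(2)) auto
    also have "\<dots> = A * B * C / (real (p + 1) * real (p + t + 1) ^ 2)"
      by (simp add: power2_eq_square)
    finally show "norm (1 / ((of_nat p * \<mu> + \<alpha>) ^ j * (of_nat (p + t) * \<mu> + \<beta>) ^ k *
            (of_nat (p + t) * \<mu> + \<gamma>) ^ l)) \<le> A * B * C / (real (p + 1) * real (p + t + 1) ^ 2)" .
  qed
qed

section \<open>The series indexed by pairs\<close>

lemma bij_betw_weak_chains_1: "bij_betw (\<lambda>p. [p]) UNIV (weak_chains 1)"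
  by (rule bij_betwI[where g = hd]) (auto simp: weak_chains_def length_Suc_conv)

text \<open>Recording the smaller entry and the gap makes the two indices independent.\<close>

lemma bij_betw_weak_chains_2: "bij_betw (\<lambda>(p, t). [p, p + t]) UNIV (weak_chains 2)"
  by (rule bij_betwI[where g = "\<lambda>ns. (ns ! 0, ns ! 1 - ns ! 0)"])
     (auto simp: weak_chains_def length_Suc_conv numeral_2_eq_2)

text \<open>Putting the larger entry outside makes the inner index range finite; this is the
  triangular form that \<open>double_sum_shift\<close> expects for \<open>Z\<close>.\<close>

lemma bij_betw_weak_chains_2':
  "bij_betw (\<lambda>(q, p). [p, q]) (SIGMA q:UNIV. {..q}) (weak_chains 2)"
  by (rule bij_betwI[where g = "\<lambda>ns. (ns ! 1, ns ! 0)"])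
     (auto simp: weak_chains_def length_Suc_conv numeral_2_eq_2)

text \<open>\<open>infsum\<close> is 0 by default on families that are not summable. Summability,
  checked on the convenient index set \<open>A\<close>, is what turns the defining sums into genuine
  values.\<close>

lemma infsum_has_sum_reindex:
  assumes "bij_betw h A B" "(\<lambda>x. f (h x)) summable_on A"
  shows "(f has_sum infsum f B) B"
  using assms by (simp add: summable_on_reindex_bij_betw)

lemma Re_divide_of_int: "Re (of_int a / of_int b) = of_int a / of_int b"
  by (metis Re_complex_of_real of_real_divide of_real_of_int_eq)

lemma Re_of_rat: "Re (of_rat r) = of_rat r"
  by (cases r) (simp add: of_rat_rat Re_divide_of_int)

lemma of_rat_shift_pos: "r > 0 \<Longrightarrow> Re (of_rat r) > 0"
  by (simp add: Re_of_rat)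

context
  fixes \<mu> :: complex
  assumes mu: "Re \<mu> > 0"
begin

lemma zeta_mu_1_has_sum:
  assumes "n > 0" "k \<ge> 2"
  shows "((\<lambda>p. \<mu> / (of_nat p * \<mu> + of_rat n) ^ k) has_sum zeta_mu \<mu> [k] [n]) UNIV"
proof -
  define F where "F ns = \<mu> / (of_nat (ns ! 0) * \<mu> + of_rat n) ^ k" for ns
  have zeta: "zeta_mu \<mu> [k] [n] = infsum F (weak_chains 1)"
    unfolding zeta_mu_def F_def by simp
  have "(\<lambda>p. \<mu> * (1 / ((of_nat p * \<mu> + of_rat n) ^ k * (of_nat p * \<mu> + of_rat n) ^ 0)))
          summable_on UNIV"
    using assms
    by (intro summable_on_cmult_right summable_on_inverse_linear_product mu of_rat_shift_pos) auto
  hence "(\<lambda>p. F [p]) summable_on UNIV"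
    by (simp add: F_def)
  hence "(F has_sum infsum F (weak_chains 1)) (weak_chains 1)"
    by (intro infsum_has_sum_reindex[OF bij_betw_weak_chains_1])
  hence "((\<lambda>p. F [p]) has_sum infsum F (weak_chains 1)) UNIV"
    by (subst has_sum_reindex_bij_betw[OF bij_betw_weak_chains_1])
  thus ?thesis
    unfolding zeta by (simp add: F_def)
qed

lemma zeta_mu_2_has_sum:
  assumes "m > 0" "n > 0" "j \<ge> 1" "k \<ge> 2"
  shows "((\<lambda>(p, t). \<mu>\<^sup>2 / ((of_nat p * \<mu> + of_rat m) ^ j * (of_nat (p + t) * \<mu> + of_rat n) ^ k))
           has_sum zeta_mu \<mu> [j, k] [m, n]) UNIV" (is ?th1)
    and "((\<lambda>(q, p). \<mu>\<^sup>2 / ((of_nat p * \<mu> + of_rat m) ^ j * (of_nat q * \<mu> + of_rat n) ^ k))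
           has_sum zeta_mu \<mu> [j, k] [m, n]) (SIGMA q:UNIV. {..q})" (is ?th2)
proof -
  define F where "F ns = \<mu>\<^sup>2 / ((of_nat (ns ! 0) * \<mu> + of_rat m) ^ j *
                             (of_nat (ns ! 1) * \<mu> + of_rat n) ^ k)" for ns
  have zeta: "zeta_mu \<mu> [j, k] [m, n] = infsum F (weak_chains 2)"
    unfolding zeta_mu_def F_def by (simp add: lessThan_Suc numeral_2_eq_2 mult.commute)
  \<comment> \<open>Since \<open>k \<ge> 2\<close>, both parts of the exponent are at least 1, as
    the three-factor summability lemma requires.\<close>
  have k: "z ^ k = z ^ 1 * z ^ (k - 1)" for z :: complex
    using assms by (simp flip: power_Suc)
  have "(\<lambda>x. \<mu>\<^sup>2 * (case x of (p, t) \<Rightarrow> 1 / ((of_nat p * \<mu> + of_rat m) ^ j *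
          (of_nat (p + t) * \<mu> + of_rat n) ^ 1 * (of_nat (p + t) * \<mu> + of_rat n) ^ (k - 1))))
          summable_on UNIV"
    using assms
    by (intro summable_on_cmult_right summable_on_pairs_inverse_linear_product mu of_rat_shift_pos)
       auto
  also have "(\<lambda>x. \<mu>\<^sup>2 * (case x of (p, t) \<Rightarrow> 1 / ((of_nat p * \<mu> + of_rat m) ^ j *
          (of_nat (p + t) * \<mu> + of_rat n) ^ 1 * (of_nat (p + t) * \<mu> + of_rat n) ^ (k - 1)))) =
        (\<lambda>x. F (case x of (p, t) \<Rightarrow> [p, p + t]))"
    unfolding F_def k by (auto simp: fun_eq_iff mult.assoc)
  finally have F: "(F has_sum zeta_mu \<mu> [j, k] [m, n]) (weak_chains 2)"
    unfolding zeta by (intro infsum_has_sum_reindex[OF bij_betw_weak_chains_2])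
  show ?th1
    using F by (subst (asm) has_sum_reindex_bij_betw[OF bij_betw_weak_chains_2, symmetric])
               (simp add: F_def case_prod_unfold)
  show ?th2
    using F by (subst (asm) has_sum_reindex_bij_betw[OF bij_betw_weak_chains_2', symmetric])
               (simp add: F_def case_prod_unfold)
qed

lemma D_mu_1_has_sum:
  assumes "m > 0" "n > 0"
  shows "((\<lambda>p. of_rat (n - m) * (\<mu> / ((of_nat p * \<mu> + of_rat m) * (of_nat p * \<mu> + of_rat n))))
           has_sum D_mu \<mu> [1] [m] [n]) UNIV"
proof -
  define F where "F ns = \<mu> / ((of_nat (last ns) * \<mu> + of_rat m) *
                             (of_nat (last ns) * \<mu> + of_rat n))" for ns
  have D: "D_mu \<mu> [1] [m] [n] = of_rat (n - m) * infsum F (weak_chains 1)"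
    unfolding D_mu_def F_def by simp
  have "(\<lambda>p. \<mu> * (1 / ((of_nat p * \<mu> + of_rat m) ^ 1 * (of_nat p * \<mu> + of_rat n) ^ 1)))
          summable_on UNIV"
    using assms
    by (intro summable_on_cmult_right summable_on_inverse_linear_product mu of_rat_shift_pos) auto
  hence "(\<lambda>p. F [p]) summable_on UNIV"
    by (simp add: F_def)
  hence "(F has_sum infsum F (weak_chains 1)) (weak_chains 1)"
    by (intro infsum_has_sum_reindex[OF bij_betw_weak_chains_1])
  hence "((\<lambda>p. F [p]) has_sum infsum F (weak_chains 1)) UNIV"
    by (subst has_sum_reindex_bij_betw[OF bij_betw_weak_chains_1])
  from has_sum_cmult_right[OF this, of "of_rat (n - m)"] show ?thesis
    unfolding D by (simp add: F_def)
qed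

lemma D_mu_2_has_sum:
  assumes "l > 0" "m > 0" "n > 0" "j \<ge> 1"
  shows "((\<lambda>(p, t). of_rat (n - m) * (\<mu>\<^sup>2 / ((of_nat p * \<mu> + of_rat l) ^ j *
             (of_nat (p + t) * \<mu> + of_rat m) * (of_nat (p + t) * \<mu> + of_rat n))))
           has_sum D_mu \<mu> [j, 1] [l, m] [l, n]) UNIV"
proof -
  define F where "F ns = \<mu>\<^sup>2 / ((of_nat (ns ! 0) * \<mu> + of_rat l) ^ j *
     (of_nat (last ns) * \<mu> + of_rat m) * (of_nat (last ns) * \<mu> + of_rat n))" for ns
  have D: "D_mu \<mu> [j, 1] [l, m] [l, n] = of_rat (n - m) * infsum F (weak_chains 2)"
    unfolding D_mu_def F_def by (simp add: numeral_2_eq_2)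
  have "(\<lambda>x. \<mu>\<^sup>2 * (case x of (p, t) \<Rightarrow> 1 / ((of_nat p * \<mu> + of_rat l) ^ j *
          (of_nat (p + t) * \<mu> + of_rat m) ^ 1 * (of_nat (p + t) * \<mu> + of_rat n) ^ 1)))
          summable_on UNIV"
    using assms
    by (intro summable_on_cmult_right summable_on_pairs_inverse_linear_product mu of_rat_shift_pos)
       auto
  also have "(\<lambda>x. \<mu>\<^sup>2 * (case x of (p, t) \<Rightarrow> 1 / ((of_nat p * \<mu> + of_rat l) ^ j *
          (of_nat (p + t) * \<mu> + of_rat m) ^ 1 * (of_nat (p + t) * \<mu> + of_rat n) ^ 1))) =
        (\<lambda>x. F (case x of (p, t) \<Rightarrow> [p, p + t]))"
    by (auto simp: fun_eq_iff F_def)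
  finally have "(F has_sum infsum F (weak_chains 2)) (weak_chains 2)"
    by (intro infsum_has_sum_reindex[OF bij_betw_weak_chains_2])
  hence "((\<lambda>x. F (case x of (p, t) \<Rightarrow> [p, p + t])) has_sum infsum F (weak_chains 2)) UNIV"
    by (subst has_sum_reindex_bij_betw[OF bij_betw_weak_chains_2])
  from has_sum_cmult_right[OF this, of "of_rat (n - m)"] show ?thesis
    unfolding D by (simp add: F_def case_prod_unfold)
qed

end

section \<open>The sum formula\<close>

text \<open>A finite geometric sum, with \<open>c\<close> as the difference of \<open>a + c\<close>
  and \<open>a\<close>. In the induction, the old sum is divided by \<open>a + c\<close> and the new
  term \<open>j = Suc M\<close> is added.\<close>

lemma geometric_partial_fraction:
  fixes a c :: "'a::field"
  assumes "a \<noteq> 0" "c \<noteq> 0" "a + c \<noteq> 0"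
  shows "(\<Sum>j=1..M. 1 / (a ^ j * (a + c) ^ (M + 1 - j))) = (1 / a ^ M - 1 / (a + c) ^ M) / c"
proof (induction M)
  case 0
  show ?case by simp
next
  case (Suc M)
  have *: "(\<Sum>j=1..M. 1 / (a ^ j * (a + c) ^ (Suc M + 1 - j))) =
        (\<Sum>j=1..M. 1 / (a ^ j * (a + c) ^ (M + 1 - j))) / (a + c)"
    unfolding sum_divide_distrib by (intro sum.cong) (auto simp: Suc_diff_le mult_ac)
  have "(\<Sum>j=1..Suc M. f j) = (\<Sum>j=1..M. f j) + f (Suc M)" for f :: "nat \<Rightarrow> 'a"
    by simp
  note split = this[of "\<lambda>j. 1 / (a ^ j * (a + c) ^ (Suc M + 1 - j))", unfolded * Suc.IH]
  show ?case
    unfolding split using assms by (simp add: divide_simps) (simp add: algebra_simps)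
qed

text \<open>Iterates \<open>1 / (x * (x + d)) = (1 / x - 1 / (x + d)) / d\<close>. The process stops
  at the product \<open>x * (x + d)\<close>, and all other exponents are at least 2, so that every
  piece still gives a convergent series when summed over linear \<open>x\<close>.\<close>

lemma diagonal_partial_fraction:
  fixes x d :: "'a::field"
  assumes "x \<noteq> 0" "d \<noteq> 0" "x + d \<noteq> 0"
  shows "1 / (x * (x + d) ^ (M + 1)) =
         1 / (x * (x + d)) / d ^ M - (\<Sum>i=1..M. 1 / ((x + d) ^ (M + 2 - i) * d ^ i))"
proof (induction M)
  case 0
  show ?case by simp
next
  case (Suc M)
  have "(\<Sum>i=1..M. 1 / ((x + d) ^ (Suc M + 2 - i) * d ^ i)) =
        (\<Sum>i=1..M. 1 / ((x + d) ^ (M + 2 - i) * d ^ i)) / (x + d)"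
    unfolding sum_divide_distrib by (intro sum.cong) (auto simp: Suc_diff_le mult_ac)
  also have "(\<Sum>i=1..M. 1 / ((x + d) ^ (M + 2 - i) * d ^ i)) =
      1 / (x * (x + d)) / d ^ M - 1 / (x * (x + d) ^ (M + 1))"
    using Suc.IH by (simp add: algebra_simps)
  finally have *: "(\<Sum>i=1..M. 1 / ((x + d) ^ (Suc M + 2 - i) * d ^ i)) =
      (1 / (x * (x + d)) / d ^ M - 1 / (x * (x + d) ^ (M + 1))) / (x + d)" .
  have "(\<Sum>i=1..Suc M. f i) = (\<Sum>i=1..M. f i) + f (Suc M)" for f :: "nat \<Rightarrow> 'a"
    by simp
  note split = this[of "\<lambda>i. 1 / ((x + d) ^ (Suc M + 2 - i) * d ^ i)", unfolded *]
  show ?case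
    unfolding split using assms
    by (simp add: divide_simps power2_eq_square) (simp add: algebra_simps)
qed

text \<open>The diagonal enters only through its value \<open>W\<close>, so the cases
  \<open>m \<noteq> n\<close> and \<open>m = n\<close> share this argument and differ only in how
  \<open>W\<close> is evaluated.\<close>

lemma zeta_mu_sum_formula:
  fixes \<mu> :: complex and m n :: rat
  assumes mu: "Re \<mu> > 0" and m: "m > 0" and n: "n > 0" and N: "N \<ge> 3"
    and W: "((\<lambda>p. \<mu>\<^sup>2 / ((of_nat p * \<mu> + of_rat m) * (of_nat p * \<mu> + of_rat n) ^ (N - 1)))
              has_sum W) UNIV"
  shows "(\<Sum>(j, k)\<in>{(j, k). j + k = N \<and> j \<ge> 1 \<and> k \<ge> 2}. zeta_mu \<mu> [j, k] [n, m + n]) =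
           zeta_mu \<mu> [1, N - 1] [m, n] - zeta_mu \<mu> [1, N - 1] [m, m + n]
           + D_mu \<mu> [N - 1, 1] [n, m] [n, m + n] - W"
proof -
  define M where "M = N - 2"
  have M: "N = M + 2" "M \<ge> 1" "N - 1 = M + 1"
    using N by (auto simp: M_def)
  define L where "L = (\<Sum>j=1..M. zeta_mu \<mu> [j, N - j] [n, m + n])"
  define a where "a p = of_nat p * \<mu> + of_rat n" for p
  define c where "c p = of_nat p * \<mu> + of_rat m" for p
  define b where "b p = of_nat p * \<mu> + of_rat (m + n)" for p
  have nz: "a p \<noteq> 0" "c p \<noteq> 0" "b p \<noteq> 0" for p
    unfolding a_def b_def c_def
    using linear_nonzero[OF mu of_rat_shift_pos[OF m]] linear_nonzero[OF mu of_rat_shift_pos[OF n]]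
      linear_nonzero[OF mu of_rat_shift_pos[OF add_pos_pos[OF m n]]] by auto
  \<comment> \<open>Indices and shifts add simultaneously; this is why the shift
    \<open>m + n\<close> belongs to the larger index.\<close>
  have b_eq: "b (p + s) = a p + c s" for p s
    by (simp add: a_def b_def c_def of_rat_add algebra_simps)
  have "(\<Sum>(j, k)\<in>{(j, k). j + k = N \<and> j \<ge> 1 \<and> k \<ge> 2}. zeta_mu \<mu> [j, k] [n, m + n]) = L"
    unfolding L_def
    by (rule sum.reindex_bij_witness[of _ "\<lambda>j. (j, N - j)" fst])
       (use N in \<open>auto simp: M_def\<close>)
  moreover have "L = zeta_mu \<mu> [1, N - 1] [m, n] - zeta_mu \<mu> [1, N - 1] [m, m + n]
           + D_mu \<mu> [N - 1, 1] [n, m] [n, m + n] - W"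
  proof -
    have L: "((\<lambda>(p, s). \<Sum>j=1..M. \<mu>\<^sup>2 / (a p ^ j * b (p + s) ^ (N - j))) has_sum L) UNIV"
      unfolding L_def case_prod_unfold a_def b_def
      by (intro has_sum_sum) (use zeta_mu_2_has_sum(1)[OF mu n] m n M in \<open>auto simp: case_prod_unfold\<close>)
    have Y0: "((\<lambda>(s, p). \<mu>\<^sup>2 / (c s ^ 1 * b (s + p) ^ (N - 1)))
               has_sum zeta_mu \<mu> [1, N - 1] [m, m + n]) UNIV"
      unfolding c_def b_def using m n N by (intro zeta_mu_2_has_sum(1) mu) auto
    \<comment> \<open>In this series the smaller entry is \<open>s\<close> and the gap is
      \<open>p\<close>; swapping the two aligns it with \<open>L\<close>.\<close>
    have "((\<lambda>(p, s). \<mu>\<^sup>2 / (c s * b (p + s) ^ (N - 1)))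
               has_sum zeta_mu \<mu> [1, N - 1] [m, m + n]) UNIV"
      using Y0 has_sum_reindex_bij_betw[OF bij_swap, of "\<lambda>(s, p). \<mu>\<^sup>2 / (c s ^ 1 * b (s + p) ^ (N - 1))"]
      by (simp add: case_prod_unfold add.commute)
    note LY = has_sum_add[OF L this]
    have geometric: "(\<Sum>j=1..M. \<mu>\<^sup>2 / (a p ^ j * b (p + s) ^ (N - j))) +
            \<mu>\<^sup>2 / (c s * b (p + s) ^ (N - 1)) =
            \<mu>\<^sup>2 / a p ^ (N - 1) * (1 / c s - 1 / b (p + s))" for p s
    proof -
      \<comment> \<open>The full geometric sum runs on to \<open>j = Suc M\<close>, where
        \<open>b\<close> has exponent 1. That term lies outside the range \<open>k \<ge> 2\<close>
        and is taken off again.\<close>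
      have "(\<Sum>j=1..M. 1 / (a p ^ j * b (p + s) ^ (N - j))) =
            (\<Sum>j=1..Suc M. 1 / (a p ^ j * b (p + s) ^ (Suc M + 1 - j)))
              - 1 / (a p ^ (M + 1) * b (p + s))"
        by (simp add: M)
      also have "\<dots> = (1 / a p ^ (M + 1) - 1 / b (p + s) ^ (M + 1)) / c s
                       - 1 / (a p ^ (M + 1) * b (p + s))"
        unfolding b_eq
        by (subst geometric_partial_fraction) (use nz b_eq[of p s] in auto)
      finally have *: "(\<Sum>j=1..M. 1 / (a p ^ j * b (p + s) ^ (N - j))) + 1 / (c s * b (p + s) ^ (N - 1)) =
         1 / a p ^ (N - 1) * (1 / c s - 1 / b (p + s))"
        by (simp add: M algebra_simps diff_divide_distrib)
      show ?thesis
        using arg_cong[OF *, of "\<lambda>z. \<mu>\<^sup>2 * z"]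
        by (simp add: sum_distrib_left distrib_left)
    qed
    have "((\<lambda>(p, s). \<mu>\<^sup>2 / a p ^ (N - 1) * (1 / c s - 1 / b (p + s)))
             has_sum (L + zeta_mu \<mu> [1, N - 1] [m, m + n])) UNIV"
      using LY unfolding case_prod_unfold geometric .
    moreover have "((\<lambda>(p, t). \<mu>\<^sup>2 / a p ^ (N - 1) * (1 / c (p + t) - 1 / b (p + t)))
             has_sum D_mu \<mu> [N - 1, 1] [n, m] [n, m + n]) UNIV"
    proof -
      \<comment> \<open>The prefactor of \<open>D_mu\<close> is the constant difference of its two
        linear forms, which turns the reciprocal of their product into a difference of
        reciprocals.\<close>
      have "b p - c p = of_rat (m + n - m)" for p
        by (simp add: b_def c_def of_rat_add)
      hence "of_rat (m + n - m) * (\<mu>\<^sup>2 / (a p ^ (N - 1) * c q * b q)) =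
             \<mu>\<^sup>2 / a p ^ (N - 1) * (1 / c q - 1 / b q)" for p q
        using nz by (simp add: diff_frac_eq mult_ac)
      moreover have "((\<lambda>(p, t). of_rat (m + n - m) * (\<mu>\<^sup>2 / (a p ^ (N - 1) * c (p + t) * b (p + t))))
             has_sum D_mu \<mu> [N - 1, 1] [n, m] [n, m + n]) UNIV"
        unfolding a_def b_def c_def using m n N by (intro D_mu_2_has_sum mu) auto
      ultimately show ?thesis by simp
    qed
    moreover have "((\<lambda>(q, p). \<mu>\<^sup>2 / a q ^ (N - 1) * (1 / c p))
             has_sum zeta_mu \<mu> [1, N - 1] [m, n]) (SIGMA q:UNIV. {..q})"
      using zeta_mu_2_has_sum(2)[OF mu m n, of 1 "N - 1"] N
      by (simp add: a_def c_def mult.commute)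
    moreover have "((\<lambda>p. \<mu>\<^sup>2 / a p ^ (N - 1) * (1 / c p)) has_sum W) UNIV"
      using W by (simp add: a_def c_def mult.commute)
    moreover have "(\<lambda>p. 1 / c p) \<longlonglongrightarrow> 0"
      unfolding c_def by (intro inverse_linear_tendsto_0 mu of_rat_shift_pos m)
    ultimately have "L + zeta_mu \<mu> [1, N - 1] [m, m + n] =
        zeta_mu \<mu> [1, N - 1] [m, n] + D_mu \<mu> [N - 1, 1] [n, m] [n, m + n] - W"
      by (intro double_sum_shift[where f = "\<lambda>p. 1 / c p" and g = "\<lambda>p. 1 / b p" and
            a = "\<lambda>p. \<mu>\<^sup>2 / a p ^ (N - 1)"])
    thus ?thesis by (simp add: algebra_simps)
  qed
  ultimately show ?thesis by simp
qed

text \<open>Evaluates \<open>W\<close> for distinct shifts: the two linear forms differ by the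
  constant \<open>n - m\<close>, so the partial fraction expansion has coefficients independent of
  \<open>p\<close> and can be summed termwise.\<close>

lemma diagonal_has_sum:
  fixes \<mu> :: complex and m n :: rat
  assumes mu: "Re \<mu> > 0" and m: "m > 0" and n: "n > 0" and mn: "m \<noteq> n" and N: "N \<ge> 3"
  shows "((\<lambda>p. \<mu>\<^sup>2 / ((of_nat p * \<mu> + of_rat m) * (of_nat p * \<mu> + of_rat n) ^ (N - 1))) has_sum
           (\<mu> * (D_mu \<mu> [1] [m] [n] / of_rat (n - m) ^ (N - 1))
            - \<mu> * (\<Sum>(i, k)\<in>{(i, k). i + k = N - 2 \<and> i \<ge> 1 \<and> k \<ge> (0::nat)}.
                 zeta_mu \<mu> [k + 2] [n] / of_rat (n - m) ^ i))) UNIV"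
proof -
  define M where "M = N - 2"
  have M: "N = M + 2" "N - 1 = M + 1"
    using N by (auto simp: M_def)
  define d :: complex where "d = of_rat (n - m)"
  define x where "x p = of_nat p * \<mu> + of_rat m" for p
  define y where "y p = of_nat p * \<mu> + of_rat n" for p
  have d: "d \<noteq> 0" using mn by (simp add: d_def)
  have y_eq: "y p = x p + d" for p
    by (simp add: x_def y_def d_def of_rat_diff)
  have nz: "x p \<noteq> 0" "y p \<noteq> 0" for p
    unfolding x_def y_def using m n by (auto intro!: linear_nonzero[OF mu] of_rat_shift_pos)
  have sum_eq: "(\<Sum>(i, k)\<in>{(i, k). i + k = N - 2 \<and> i \<ge> 1 \<and> k \<ge> (0::nat)}.
                 zeta_mu \<mu> [k + 2] [n] / of_rat (n - m) ^ i) =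
             (\<Sum>i=1..M. 1 / d ^ i * zeta_mu \<mu> [M + 2 - i] [n])"
    by (rule sum.reindex_bij_witness[of _ "\<lambda>i. (i, M - i)" fst]) (auto simp: M d_def)
  have D: "((\<lambda>p. d * (\<mu> / (x p * y p))) has_sum D_mu \<mu> [1] [m] [n]) UNIV"
    unfolding d_def x_def y_def by (rule D_mu_1_has_sum[OF mu m n])
  \<comment> \<open>\<open>D_mu\<close> already contains a factor \<open>d\<close>, so the power
    \<open>d ^ M\<close> of the partial fraction becomes \<open>d ^ (N - 1)\<close>.\<close>
  have "((\<lambda>p. \<mu> / d ^ (N - 1) * (d * (\<mu> / (x p * y p)))
              - \<mu> * (\<Sum>i=1..M. 1 / d ^ i * (\<mu> / y p ^ (M + 2 - i)))) has_sum
         (\<mu> / d ^ (N - 1) * D_mu \<mu> [1] [m] [n]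
              - \<mu> * (\<Sum>i=1..M. 1 / d ^ i * zeta_mu \<mu> [M + 2 - i] [n]))) UNIV"
    unfolding y_def
    by (intro has_sum_diff has_sum_cmult_right has_sum_sum D[unfolded y_def] zeta_mu_1_has_sum mu n)
       auto
  also have "(\<lambda>p. \<mu> / d ^ (N - 1) * (d * (\<mu> / (x p * y p)))
              - \<mu> * (\<Sum>i=1..M. 1 / d ^ i * (\<mu> / y p ^ (M + 2 - i)))) =
             (\<lambda>p. \<mu>\<^sup>2 / (x p * y p ^ (N - 1)))"
  proof
    fix p
    have "1 / (x p * y p ^ (M + 1)) =
         1 / (x p * y p) / d ^ M - (\<Sum>i=1..M. 1 / (y p ^ (M + 2 - i) * d ^ i))"
      unfolding y_eq by (rule diagonal_partial_fraction) (use nz d y_eq[of p] in auto)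
    from arg_cong[OF this, of "\<lambda>z. \<mu>\<^sup>2 * z"]
    show "\<mu> / d ^ (N - 1) * (d * (\<mu> / (x p * y p)))
              - \<mu> * (\<Sum>i=1..M. 1 / d ^ i * (\<mu> / y p ^ (M + 2 - i))) =
             \<mu>\<^sup>2 / (x p * y p ^ (N - 1))"
      using d by (simp add: M sum_distrib_left right_diff_distrib power2_eq_square mult_ac)
  qed
  finally show ?thesis
    unfolding sum_eq by (simp add: x_def y_def d_def)
qed

theorem theorem5p3:
  fixes \<mu> :: complex
  assumes "Re \<mu> > 0"
  shows "(\<forall>(m::rat) (n::rat) (N::nat). m > 0 \<longrightarrow> n > 0 \<longrightarrow> m \<noteq> n \<longrightarrow> N \<ge> 3 \<longrightarrow>
      (\<Sum>(j, k)\<in>{(j, k). j + k = N \<and> j \<ge> 1 \<and> k \<ge> 2}. zeta_mu \<mu> [j, k] [n, m + n]) =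
        zeta_mu \<mu> [1, N - 1] [m, n] - zeta_mu \<mu> [1, N - 1] [m, m + n]
        - \<mu> * (D_mu \<mu> [1] [m] [n] / of_rat (n - m) ^ (N - 1))
        + D_mu \<mu> [N - 1, 1] [n, m] [n, m + n]
        + \<mu> * (\<Sum>(i, k)\<in>{(i, k). i + k = N - 2 \<and> i \<ge> 1 \<and> k \<ge> (0::nat)}.
                 zeta_mu \<mu> [k + 2] [n] / of_rat (n - m) ^ i))
    \<and> (\<forall>(n::rat) (N::nat). n > 0 \<longrightarrow> N \<ge> 3 \<longrightarrow>
      (\<Sum>(j, k)\<in>{(j, k). j + k = N \<and> j \<ge> 1 \<and> k \<ge> 2}. zeta_mu \<mu> [j, k] [n, 2 * n]) =
        zeta_mu \<mu> [1, N - 1] [n, n] - zeta_mu \<mu> [1, N - 1] [n, 2 * n]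
        - \<mu> * zeta_mu \<mu> [N] [n]
        + D_mu \<mu> [N - 1, 1] [n, n] [n, 2 * n])"
proof (intro conjI allI impI)
  fix m n :: rat and N :: nat
  assume *: "m > 0" "n > 0" "m \<noteq> n" "N \<ge> 3"
  show "(\<Sum>(j, k)\<in>{(j, k). j + k = N \<and> j \<ge> 1 \<and> k \<ge> 2}. zeta_mu \<mu> [j, k] [n, m + n]) =
        zeta_mu \<mu> [1, N - 1] [m, n] - zeta_mu \<mu> [1, N - 1] [m, m + n]
        - \<mu> * (D_mu \<mu> [1] [m] [n] / of_rat (n - m) ^ (N - 1))
        + D_mu \<mu> [N - 1, 1] [n, m] [n, m + n]
        + \<mu> * (\<Sum>(i, k)\<in>{(i, k). i + k = N - 2 \<and> i \<ge> 1 \<and> k \<ge> (0::nat)}.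
                 zeta_mu \<mu> [k + 2] [n] / of_rat (n - m) ^ i)"
    unfolding zeta_mu_sum_formula[OF assms *(1,2,4) diagonal_has_sum[OF assms *]]
    by (simp only: algebra_simps)
next
  fix n :: rat and N :: nat
  assume *: "n > 0" "N \<ge> 3"
  \<comment> \<open>For equal shifts the two linear forms on the diagonal coincide, and
    \<open>W\<close> is a depth-one series of exponent \<open>N\<close>.\<close>
  have "((\<lambda>p. \<mu> * (\<mu> / (of_nat p * \<mu> + of_rat n) ^ N)) has_sum \<mu> * zeta_mu \<mu> [N] [n]) UNIV"
    using * by (intro has_sum_cmult_right zeta_mu_1_has_sum assms) auto
  moreover have "\<mu> * (\<mu> / z ^ N) = \<mu>\<^sup>2 / (z * z ^ (N - 1))" for z
    using * by (simp add: power2_eq_square flip: power_Suc)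
  ultimately have "((\<lambda>p. \<mu>\<^sup>2 / ((of_nat p * \<mu> + of_rat n) * (of_nat p * \<mu> + of_rat n) ^ (N - 1)))
                     has_sum \<mu> * zeta_mu \<mu> [N] [n]) UNIV"
    by simp
  from zeta_mu_sum_formula[OF assms *(1,1,2) this]
  show "(\<Sum>(j, k)\<in>{(j, k). j + k = N \<and> j \<ge> 1 \<and> k \<ge> 2}. zeta_mu \<mu> [j, k] [n, 2 * n]) =
        zeta_mu \<mu> [1, N - 1] [n, n] - zeta_mu \<mu> [1, N - 1] [n, 2 * n]
        - \<mu> * zeta_mu \<mu> [N] [n]
        + D_mu \<mu> [N - 1, 1] [n, n] [n, 2 * n]"
    by (simp flip: mult_2)
qed

end
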